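(* For the graph $G=K_k\,\square\,P_\ell$ with $k,\ell\ge 3$, $\bar{\gamma}_p(G)=(k-2)\left\lfloor\frac{\ell-1}{2}\right\rfloor$.
   Context: $K_k$ is the complete graph on $k$ vertices and $P_\ell$ the path on $\ell$ vertices. The Cartesian product $G\,\square\,H$ has vertex set $V(G)\times V(H)$, with $(u_1,v_1)$ adjacent to $(u_2,v_2)$ iff either $u_1=u_2$ and $\{v_1,v_2\}\in E(H)$, or $\{u_1,u_2\}\in E(G)$ and $v_1=v_2$. For $v\in V$, $N[v]$ is the closed neighborhood; for $S\subseteq V$, $N[S]=\bigcup_{v\in S}N[v]$. Define $\mathcal{P}^0(S)=N[S]$, $\mathcal{P}^{i+1}(S)=\mathcal{P}^i(S)\cup\{w : \{w\}=N[v]\setminus\mathcal{P}^i(S)\text{ for some } v\in\mathcal{P}^i(S)\}$, with eventual value $\mathcal{P}^\infty(S)$. $S$ is a power dominating set (PDS) if $\mathcal{P}^\infty(S)=V$, and a failed power dominating set (FPDS) otherwise. $\bar{\gamma}_p(G)$ is the maximum cardinality of an FPDS of $G$. *)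

theory Defs
  imports Main
begin

text \<open>A graph is given by its vertex set and its set of unordered edges.\<close>

record 'a ugraph =
  verts :: "'a set"
  edges :: "'a set set"

definition fin_simple_graph :: "'a ugraph \<Rightarrow> bool" where
  "fin_simple_graph G \<longleftrightarrow> finite (verts G) \<and>
     (\<forall>e \<in> edges G. e \<subseteq> verts G \<and> card e = 2)"

definition complete_graph :: "nat \<Rightarrow> nat ugraph" where
  "complete_graph k = \<lparr> verts = {..<k},
     edges = {{u, v} | u v. u < k \<and> v < k \<and> u \<noteq> v} \<rparr>"

definition path_graph :: "nat \<Rightarrow> nat ugraph" where
  "path_graph l = \<lparr> verts = {..<l}, edges = {{i, Suc i} | i. Suc i < l} \<rparr>"

definition cartesian_product :: "'a ugraph \<Rightarrow> 'b ugraph \<Rightarrow> ('a \<times> 'b) ugraph"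
    (infixr "\<box>" 75) where
  "G \<box> H = \<lparr> verts = verts G \<times> verts H,
     edges = {{(u\<^sub>1, v\<^sub>1), (u\<^sub>2, v\<^sub>2)} | u\<^sub>1 v\<^sub>1 u\<^sub>2 v\<^sub>2.
       (u\<^sub>1, v\<^sub>1) \<in> verts G \<times> verts H \<and> (u\<^sub>2, v\<^sub>2) \<in> verts G \<times> verts H \<and>
       (u\<^sub>1 = u\<^sub>2 \<and> {v\<^sub>1, v\<^sub>2} \<in> edges H \<or> {u\<^sub>1, u\<^sub>2} \<in> edges G \<and> v\<^sub>1 = v\<^sub>2)} \<rparr>"

definition closed_nbhd :: "'a ugraph \<Rightarrow> 'a \<Rightarrow> 'a set" where
  "closed_nbhd G v = insert v {w \<in> verts G. {v, w} \<in> edges G}"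

fun observed :: "'a ugraph \<Rightarrow> 'a set \<Rightarrow> nat \<Rightarrow> 'a set" where
  "observed G S 0 = (\<Union>v\<in>S. closed_nbhd G v)"
| "observed G S (Suc i) = observed G S i \<union>
     {w. \<exists>v \<in> observed G S i. {w} = closed_nbhd G v - observed G S i}"

text \<open>The sets \<open>observed G S i\<close> increase with \<open>i\<close>, so on a finite graph their union is the
  value at which they become stationary; see \<open>observed_eventually\<close> below.\<close>

definition observed_inf :: "'a ugraph \<Rightarrow> 'a set \<Rightarrow> 'a set" where
  "observed_inf G S = (\<Union>i. observed G S i)"

definition power_dominating :: "'a ugraph \<Rightarrow> 'a set \<Rightarrow> bool" where
  "power_dominating G S \<longleftrightarrow> S \<subseteq> verts G \<and> observed_inf G S = verts G"

definition failed_power_dominating :: "'a ugraph \<Rightarrow> 'a set \<Rightarrow> bool" where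
  "failed_power_dominating G S \<longleftrightarrow> S \<subseteq> verts G \<and> observed_inf G S \<noteq> verts G"

definition failed_power_domination_number :: "'a ugraph \<Rightarrow> nat" where
  "failed_power_domination_number G = Max {card S | S. failed_power_dominating G S}"

lemma fin_simple_complete_graph: "fin_simple_graph (complete_graph k)"
  by (auto simp: fin_simple_graph_def complete_graph_def card_insert_if)

lemma fin_simple_path_graph: "fin_simple_graph (path_graph l)"
  by (auto simp: fin_simple_graph_def path_graph_def card_insert_if)

lemma fin_simple_cartesian_product:
  assumes "fin_simple_graph G" "fin_simple_graph H"
  shows "fin_simple_graph (G \<box> H)"
proof -
  have "x \<noteq> y" if "{x, y} \<in> edges G" for x y
    using assms(1) that by (auto simp: fin_simple_graph_def)
  moreover have "x \<noteq> y" if "{x, y} \<in> edges H" for x y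
    using assms(2) that by (auto simp: fin_simple_graph_def)
  ultimately show ?thesis
    using assms by (fastforce simp: fin_simple_graph_def cartesian_product_def card_insert_if)
qed

lemma cartesian_product_adjacent:
  assumes "(u\<^sub>1, v\<^sub>1) \<in> verts G \<times> verts H" "(u\<^sub>2, v\<^sub>2) \<in> verts G \<times> verts H"
  shows "{(u\<^sub>1, v\<^sub>1), (u\<^sub>2, v\<^sub>2)} \<in> edges (G \<box> H) \<longleftrightarrow>
    u\<^sub>1 = u\<^sub>2 \<and> {v\<^sub>1, v\<^sub>2} \<in> edges H \<or> {u\<^sub>1, u\<^sub>2} \<in> edges G \<and> v\<^sub>1 = v\<^sub>2"
  using assms by (fastforce simp: cartesian_product_def doubleton_eq_iff insert_commute)

lemma observed_subset_verts:
  assumes "S \<subseteq> verts G"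
  shows "observed G S i \<subseteq> verts G"
proof (induction i)
  case 0
  then show ?case using assms by (auto simp: closed_nbhd_def)
next
  case (Suc i)
  have "w \<in> verts G" if "v \<in> observed G S i" "{w} = closed_nbhd G v - observed G S i" for v w
  proof -
    have "w \<in> closed_nbhd G v" using that(2) by blast
    then show ?thesis using that(1) Suc by (auto simp: closed_nbhd_def)
  qed
  then show ?case using Suc by auto
qed

lemma observed_mono: "i \<le> j \<Longrightarrow> observed G S i \<subseteq> observed G S j"
  by (rule lift_Suc_mono_le) auto

lemma observed_eventually:
  assumes "finite (verts G)" "S \<subseteq> verts G"
  shows "\<exists>n. \<forall>i \<ge> n. observed G S i = observed_inf G S"
proof -
  have fin: "finite (observed_inf G S)"
    unfolding observed_inf_def
    by (rule finite_subset[OF _ assms(1)]) (use observed_subset_verts[OF assms(2)] in blast)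
  have "\<forall>x \<in> observed_inf G S. \<exists>i. x \<in> observed G S i"
    by (auto simp: observed_inf_def)
  then obtain f where f: "\<And>x. x \<in> observed_inf G S \<Longrightarrow> x \<in> observed G S (f x)"
    by metis
  define n where "n = Max (insert 0 (f ` observed_inf G S))"
  have "observed G S i = observed_inf G S" if "n \<le> i" for i
  proof
    show "observed G S i \<subseteq> observed_inf G S" by (auto simp: observed_inf_def)
    show "observed_inf G S \<subseteq> observed G S i"
    proof
      fix x assume x: "x \<in> observed_inf G S"
      have "f x \<le> n" unfolding n_def using fin x by (intro Max_ge) auto
      then show "x \<in> observed G S i"
        using f[OF x] observed_mono[of "f x" i G S] that by auto
    qed
  qed
  then show ?thesis by blast
qed

text \<open>The maximum in \<open>failed_power_domination_number\<close> is taken over a finite nonempty set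
  whenever the graph is finite and nonempty.\<close>

lemma failed_cards_finite_nonempty:
  assumes "finite (verts G)" "verts G \<noteq> {}"
  shows "finite {card S | S. failed_power_dominating G S}"
    and "{card S | S. failed_power_dominating G S} \<noteq> {}"
proof -
  have "finite (card ` Pow (verts G))" using assms(1) by simp
  then show "finite {card S | S. failed_power_dominating G S}"
    by (rule rev_finite_subset) (auto simp: failed_power_dominating_def)
  have "observed G {} i = {}" for i by (induction i) auto
  then have "failed_power_dominating G {}"
    using assms(2) by (simp add: failed_power_dominating_def observed_inf_def)
  then show "{card S | S. failed_power_dominating G S} \<noteq> {}" by blast
qed

end

theory Submission
  imports Defs
begin

text \<open>A set fails to power dominate exactly when its neighbourhood misses a \<^emph>\<open>fort\<close>: a nonempty
  set \<open>U\<close> such that no vertex outside \<open>U\<close> has exactly one neighbour in \<open>U\<close>. Cut a fort in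
  \<open>K\<^sub>k \<box> P\<^sub>l\<close> into its columns \<open>u\<^sub>j\<close>. Only vertices in an empty column can avoid \<open>N[U]\<close>. Two
  consecutive empty columns would force \<open>U = {}\<close>, so an empty column is interior and its two
  neighbours agree; it contributes \<open>k - |u\<^sub>j\<^sub>-\<^sub>1|\<close> vertices. This is at most \<open>k - 2\<close> unless
  \<open>u\<^sub>j\<^sub>-\<^sub>1\<close> is a singleton, but then the columns at distance two from \<open>j\<close> contain all but at most
  one vertex. Charging an ordinary empty column to \<open>{j, j+1}\<close> and an exceptional one to
  \<open>{j-1, \<dots>, j+2}\<close> gives disjoint blocks that avoid the first column, and
  \<open>k - 1 \<le> 2(k - 2)\<close> yields the bound. Equality is attained by the fort consisting of two rows
  of the even columns and the last column.\<close>

section \<open>Forts as obstructions to power domination\<close>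

lemma not_singleton_if_pair_subset: "{a, b} \<subseteq> A \<Longrightarrow> a \<noteq> b \<Longrightarrow> A \<noteq> {x}"
  by auto

text \<open>Since \<open>v\<close> lies outside \<open>U\<close>, its closed neighbourhood meets
  \<open>U\<close> only in proper neighbours of \<open>v\<close>.\<close>

definition fort :: "'a ugraph \<Rightarrow> 'a set \<Rightarrow> bool" where
  "fort G U \<longleftrightarrow> U \<noteq> {} \<and> U \<subseteq> verts G \<and>
     (\<forall>v \<in> verts G - U. \<forall>w. closed_nbhd G v \<inter> U \<noteq> {w})"

lemma closed_nbhd_subset_verts: "v \<in> verts G \<Longrightarrow> closed_nbhd G v \<subseteq> verts G"
  by (auto simp: closed_nbhd_def)

text \<open>The first vertex of \<open>U\<close> to be observed would be forced by some
  \<open>v\<close> outside \<open>U\<close>. As all of \<open>U\<close> is still unobserved then, it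
  would be the only neighbour of \<open>v\<close> in \<open>U\<close>.\<close>

lemma observed_disjoint_fort:
  assumes S: "S \<subseteq> verts G" and U: "fort G U"
    and disj: "\<And>v. v \<in> S \<Longrightarrow> closed_nbhd G v \<inter> U = {}"
  shows "observed G S i \<inter> U = {}"
proof (induction i)
  case 0
  then show ?case using disj by auto
next
  case (Suc i)
  have False if w: "w \<in> U" and v: "v \<in> observed G S i"
    and eq: "{w} = closed_nbhd G v - observed G S i" for v w
  proof -
    have "closed_nbhd G v \<inter> U = {w}" using Suc w eq by blast
    moreover have "v \<in> verts G - U"
      using v Suc observed_subset_verts[OF S] by blast
    ultimately show False using U by (auto simp: fort_def)
  qed
  then show ?case using Suc by auto
qed

text \<open>For a failed \<open>S\<close>, the never observed vertices form the fort: an observed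
  vertex with exactly one neighbour among them would force it even after stabilisation.\<close>

lemma failed_power_dominating_iff_fort:
  assumes fin: "finite (verts G)"
  shows "failed_power_dominating G S \<longleftrightarrow>
    S \<subseteq> verts G \<and> (\<exists>U. fort G U \<and> (\<forall>v\<in>S. closed_nbhd G v \<inter> U = {}))"
proof
  assume "failed_power_dominating G S"
  then have S: "S \<subseteq> verts G" and ne: "observed_inf G S \<noteq> verts G"
    by (auto simp: failed_power_dominating_def)
  obtain n where n: "\<And>i. i \<ge> n \<Longrightarrow> observed G S i = observed_inf G S"
    using observed_eventually[OF fin S] by blast
  let ?U = "verts G - observed_inf G S"
  have "observed_inf G S \<subseteq> verts G"
    using observed_subset_verts[OF S] by (auto simp: observed_inf_def)
  then have "?U \<noteq> {}" using ne by blast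
  moreover have False
    if v: "v \<in> verts G - ?U" and eq: "closed_nbhd G v \<inter> ?U = {w}" for v w
  proof -
    have "{w} = closed_nbhd G v - observed G S n"
      using eq v closed_nbhd_subset_verts[of v G] n[of n] by auto
    moreover have "v \<in> observed G S n" using v n[of n] by auto
    ultimately have "w \<in> observed G S (Suc n)" by auto
    then have "w \<in> observed_inf G S" unfolding n[of "Suc n", OF le_SucI[OF order_refl]] .
    then show False using eq by blast
  qed
  ultimately have "fort G ?U" by (auto simp: fort_def)
  moreover have "closed_nbhd G v \<inter> ?U = {}" if "v \<in> S" for v
  proof -
    have "closed_nbhd G v \<subseteq> observed G S 0" using that by auto
    then show ?thesis unfolding observed_inf_def by blast
  qed
  ultimately show "S \<subseteq> verts G \<and> (\<exists>U. fort G U \<and> (\<forall>v\<in>S. closed_nbhd G v \<inter> U = {}))"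
    using S by blast
next
  assume "S \<subseteq> verts G \<and> (\<exists>U. fort G U \<and> (\<forall>v\<in>S. closed_nbhd G v \<inter> U = {}))"
  then obtain U where S: "S \<subseteq> verts G" and U: "fort G U"
    and disj: "\<And>v. v \<in> S \<Longrightarrow> closed_nbhd G v \<inter> U = {}" by blast
  have "observed_inf G S \<inter> U = {}"
    using observed_disjoint_fort[OF S U disj] by (auto simp: observed_inf_def)
  then show "failed_power_dominating G S"
    using S U by (auto simp: failed_power_dominating_def fort_def)
qed

section \<open>Neighbourhoods in the product graph\<close>

lemma verts_complete_path: "verts (complete_graph k \<box> path_graph l) = {..<k} \<times> {..<l}"
  by (simp add: cartesian_product_def complete_graph_def path_graph_def)

lemma closed_nbhd_complete_path:
  assumes "c < k" "j < l"
  shows "closed_nbhd (complete_graph k \<box> path_graph l) (c, j) =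
    {(d, i). d < k \<and> i < l \<and> (i = j \<or> d = c \<and> (i = Suc j \<or> j = Suc i))}"
proof -
  have adj: "{(c, j), (d, i)} \<in> edges (complete_graph k \<box> path_graph l) \<longleftrightarrow>
      c = d \<and> (i = Suc j \<or> j = Suc i) \<or> c \<noteq> d \<and> i = j" if "d < k" "i < l" for d i
    using assms that
    by (subst cartesian_product_adjacent)
      (auto simp: complete_graph_def path_graph_def doubleton_eq_iff)
  show ?thesis
    using assms adj by (auto simp: closed_nbhd_def verts_complete_path)
qed

section \<open>Upper bound from the columns of a fort\<close>

text \<open>Columns are numbered from 1 to \<open>l\<close>, so that the empty columns \<open>0\<close> and \<open>l + 1\<close> can pad
  both ends.\<close>

lemma column_bound:
  fixes k l :: nat and u s :: "nat \<Rightarrow> nat set"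
  assumes k: "k \<ge> 3"
    and u_sub: "\<And>j. u j \<subseteq> {..<k}"
    and pad: "u 0 = {}" "\<And>j. j > l \<Longrightarrow> u j = {}"
    and ne: "u i \<noteq> {}"
    and empty: "\<And>j. 1 \<le> j \<Longrightarrow> j \<le> l \<Longrightarrow> u j = {} \<Longrightarrow> u (j - 1) = u (Suc j)"
    and single: "\<And>j c. 1 \<le> j \<Longrightarrow> j \<le> l \<Longrightarrow> u j = {c} \<Longrightarrow>
      {..<k} - {c} \<subseteq> u (j - 1) \<union> u (Suc j)"
    and s_sub: "\<And>j. 1 \<le> j \<Longrightarrow> j \<le> l \<Longrightarrow> s j \<subseteq> {..<k} - u (j - 1)"
    and s_empty: "\<And>j. 1 \<le> j \<Longrightarrow> j \<le> l \<Longrightarrow> u j \<noteq> {} \<Longrightarrow> s j = {}"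
  shows "(\<Sum>j=1..l. card (s j)) \<le> (k - 2) * ((l - 1) div 2)"
proof -
  define P where "P j \<longleftrightarrow> u j = {} \<and> u (Suc j) = {}" for j
  \<comment> \<open>If column \<open>Suc j\<close> is empty, columns \<open>j\<close> and
    \<open>j + 2\<close> agree, so a pair of consecutive empty columns spreads in both
    directions.\<close>
  have step: "P j \<longleftrightarrow> P (Suc j)" if "j < l" for j
    using empty[of "Suc j"] that by (auto simp: P_def)
  have P0: "P j \<longleftrightarrow> P 0" if "j \<le> l" for j
    using that by (induction j) (auto simp: step)
  have il: "i \<le> l" using pad(2)[of i] ne by force
  have notP: "\<not> P j" if "j \<le> l" for j
    using P0[OF that] P0[OF il] ne by (auto simp: P_def)
  have fin_u: "finite (u j)" for j using u_sub finite_subset by blast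
  define E where "E = {j \<in> {1..l}. u j = {}}"
  have E: "2 \<le> j" "Suc j \<le> l" "u (j - 1) \<noteq> {}" "u (Suc j) = u (j - 1)" "u j = {}"
    if "j \<in> E" for j
  proof -
    have j: "1 \<le> j" "j \<le> l" "u j = {}" using that by (auto simp: E_def)
    show eq: "u (Suc j) = u (j - 1)" using empty[of j] j by simp
    show ne': "u (j - 1) \<noteq> {}" using notP[of "j - 1"] j by (auto simp: P_def)
    show "2 \<le> j" using ne' pad(1) j by (cases "j = 1") auto
    show "Suc j \<le> l" using ne' pad(2)[of "Suc j"] eq by force
    show "u j = {}" by fact
  qed
  define T where "T j \<longleftrightarrow> card (u (j - 1)) = 1" for j
  have T: "3 \<le> j" "j + 2 \<le> l" "2 \<le> card (u (j - 2))" "2 \<le> card (u (j + 2))"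
    if "j \<in> E" "T j" for j
  \<comment> \<open>Column \<open>j\<close> is empty, so \<open>single\<close> puts the complement
    of \<open>c\<close> into column \<open>j - 2\<close>, and likewise into \<open>j + 2\<close>. It
    has \<open>k - 1 \<ge> 2\<close> elements, which rules out the padding columns.\<close>
  proof -
    note Ej = E[OF that(1)]
    from that(2) obtain c where c: "u (j - 1) = {c}" by (auto simp: T_def card_1_singleton_iff)
    have "{..<k} - {c} \<subseteq> u (j - 2)"
      using single[of "j - 1" c] c Ej by (simp add: diff_diff_add numeral_2_eq_2)
    moreover have "{..<k} - {c} \<subseteq> u (j + 2)"
      using single[of "Suc j" c] c Ej by simp
    moreover have "2 \<le> card ({..<k} - {c})"
      using k by (auto simp: card_Diff_singleton_if)
    ultimately show big: "2 \<le> card (u (j - 2))" "2 \<le> card (u (j + 2))"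
      using card_mono[OF fin_u] le_trans by metis+
    show "3 \<le> j"
    proof (rule ccontr)
      assume "\<not> 3 \<le> j"
      then have "j - 2 = 0" by simp
      then show False using big(1) pad(1) by simp
    qed
    show "j + 2 \<le> l" using big(2) pad(2)[of "j + 2"] by force
  qed
  define B where "B j = (if T j then {j - 1..j + 2} else {j, j + 1})" for j
  \<comment> \<open>\<open>w j\<close> is the number of units of \<open>k - 2\<close> granted to
    column \<open>j\<close>, one for every two columns of its block.\<close>
  define w :: "nat \<Rightarrow> nat" where "w j = (if T j then 2 else 1)" for j
  have cardB: "card (B j) = 2 * w j" if "j \<in> E" for j
    using E(1)[OF that] by (auto simp: B_def w_def)
  have B_sub: "B j \<subseteq> {2..l}" if "j \<in> E" for j
    using E(1,2)[OF that] T(1,2)[OF that] by (auto simp: B_def)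
  have disj: "B i \<inter> B j = {}" if ij: "i \<in> E" "j \<in> E" "i < j" for i j
  proof -
    have ne1: "j \<noteq> i + 1" using E(3)[OF ij(2)] E(5)[OF ij(1)] by auto
    have ne2: "j \<noteq> i + 2" if "T i \<or> T j"
      using T(3)[OF ij(2)] T(4)[OF ij(1)] E(5)[OF ij(1)] E(5)[OF ij(2)] that by auto
    have ne3: "j \<noteq> i + 3" if "T i" "T j"
      using T(4)[OF ij(1) that(1)] \<open>T j\<close> by (auto simp: T_def)
    show ?thesis using ij(3) ne1 ne2 ne3 by (auto simp: B_def)
  qed
  have finE: "finite E" by (simp add: E_def)
  have "2 * (\<Sum>j\<in>E. w j) = (\<Sum>j\<in>E. card (B j))"
    by (simp add: sum_distrib_left cardB)
  also have "\<dots> = card (\<Union>j\<in>E. B j)"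
  proof (rule card_UN_disjoint[symmetric])
    show "\<forall>i\<in>E. \<forall>j\<in>E. i \<noteq> j \<longrightarrow> B i \<inter> B j = {}"
      using disj by (metis inf_commute linorder_neqE_nat)
  qed (auto simp: finE B_def)
  \<comment> \<open>No block contains column 1, so the blocks share \<open>l - 1\<close> columns;
    halving gives the floor.\<close>
  also have "\<dots> \<le> card {2..l}"
    using B_sub by (intro card_mono) auto
  finally have w: "(\<Sum>j\<in>E. w j) \<le> (l - 1) div 2" by simp
  have s_le: "card (s j) \<le> (k - 2) * w j" if "j \<in> E" for j
  proof -
    have "card (s j) \<le> card ({..<k} - u (j - 1))"
      using s_sub[of j] E(1,2)[OF that] by (intro card_mono) auto
    also have "\<dots> = k - card (u (j - 1))"
      using u_sub fin_u by (simp add: card_Diff_subset)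
    finally have le: "card (s j) \<le> k - card (u (j - 1))" .
    \<comment> \<open>Two cases remain: cardinality 1, where \<open>k - 1 \<le> 2 * (k - 2)\<close>
      as \<open>k \<ge> 3\<close>, and cardinality at least 2.\<close>
    have "card (u (j - 1)) \<noteq> 0" using E(3)[OF that] fin_u by simp
    then show ?thesis using le k by (auto simp: w_def T_def)
  qed
  have "(\<Sum>j=1..l. card (s j)) = (\<Sum>j\<in>E. card (s j))"
    using s_empty by (intro sum.mono_neutral_right) (auto simp: E_def)
  also have "\<dots> \<le> (\<Sum>j\<in>E. (k - 2) * w j)" by (intro sum_mono s_le)
  also have "\<dots> \<le> (k - 2) * ((l - 1) div 2)"
    using w by (simp add: sum_distrib_left[symmetric])
  finally show ?thesis .
qed

lemma failed_card_le:
  assumes k: "k \<ge> 3" and S: "failed_power_dominating (complete_graph k \<box> path_graph l) S"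
  shows "card S \<le> (k - 2) * ((l - 1) div 2)"
proof -
  let ?G = "complete_graph k \<box> path_graph l"
  have fin: "finite (verts ?G)" by (simp add: verts_complete_path)
  obtain U where S_sub: "S \<subseteq> {..<k} \<times> {..<l}" and U: "fort ?G U"
    and disj: "\<And>v. v \<in> S \<Longrightarrow> closed_nbhd ?G v \<inter> U = {}"
    using S failed_power_dominating_iff_fort[OF fin] by (auto simp: verts_complete_path)
  have U_sub: "U \<subseteq> {..<k} \<times> {..<l}" and U_ne: "U \<noteq> {}"
    using U by (auto simp: fort_def verts_complete_path)
  \<comment> \<open>Path vertex \<open>j - 1\<close> becomes column \<open>j\<close>; the guard
    \<open>j > 0\<close> keeps truncated subtraction from filling column 0.\<close>
  define u where "u j = {c. j > 0 \<and> (c, j - 1) \<in> U}" for j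
  define s where "s j = {c. j > 0 \<and> (c, j - 1) \<in> S}" for j
  \<comment> \<open>For \<open>j = 1\<close> the truncated \<open>j - 2\<close> does no harm, since
    \<open>u 0\<close> is empty.\<close>
  have nb: "closed_nbhd ?G (c, j - 1) \<inter> U =
      (\<lambda>d. (d, j - 1)) ` u j \<union> (if c \<in> u (j - 1) then {(c, j - 2)} else {}) \<union>
      (if c \<in> u (Suc j) then {(c, j)} else {})"
    if "c < k" "1 \<le> j" "j \<le> l" for c j
    using that U_sub by (cases j) (auto simp: closed_nbhd_complete_path u_def split: if_splits)
  have uD: "c < k \<and> j \<le> l" if "c \<in> u j" for c j using that U_sub by (auto simp: u_def)
  have fort: "closed_nbhd ?G (c, j - 1) \<inter> U \<noteq> {v}"
    if "c < k" "1 \<le> j" "j \<le> l" "c \<notin> u j" for c j v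
    using U that by (auto simp: fort_def verts_complete_path u_def)
  obtain c i where ci: "(c, i) \<in> U" using U_ne by auto
  have "(\<Sum>j=1..l. card (s j)) \<le> (k - 2) * ((l - 1) div 2)"
  proof (rule column_bound[OF k, of u l "Suc i"])
    show "u j \<subseteq> {..<k}" for j using uD by auto
    show "u 0 = {}" by (simp add: u_def)
    show "u j = {}" if "j > l" for j using uD[of _ j] that by auto
    show "u (Suc i) \<noteq> {}" using ci by (auto simp: u_def)
    show "u (j - 1) = u (Suc j)" if j: "1 \<le> j" "j \<le> l" "u j = {}" for j
    proof -
      have "c \<in> u (j - 1) \<longleftrightarrow> c \<in> u (Suc j)" if "c < k" for c
        using fort[OF that j(1,2)] nb[OF that j(1,2)] j(3) by (auto split: if_splits)
      then show ?thesis using uD by blast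
    qed
    show "{..<k} - {c} \<subseteq> u (j - 1) \<union> u (Suc j)"
      if j: "1 \<le> j" "j \<le> l" "u j = {c}" for j c
    proof
      fix d assume d: "d \<in> {..<k} - {c}"
      \<comment> \<open>\<open>(d, j - 1)\<close> sees \<open>(c, j - 1)\<close>, the only vertex of
        \<open>U\<close> in its column, so the fort demands a second neighbour, which must lie in
        row \<open>d\<close>.\<close>
      then show "d \<in> u (j - 1) \<union> u (Suc j)"
        using fort[of d j "(c, j - 1)"] nb[of d j] j by (auto split: if_splits)
    qed
    show "s j \<subseteq> {..<k} - u (j - 1)" if j: "1 \<le> j" "j \<le> l" for j
    proof
      fix c assume c: "c \<in> s j"
      then have "c < k" using S_sub by (auto simp: s_def)
      then show "c \<in> {..<k} - u (j - 1)"
        using disj[of "(c, j - 1)"] c nb[of c j] j by (auto simp: s_def)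
    qed
    show "s j = {}" if j: "1 \<le> j" "j \<le> l" "u j \<noteq> {}" for j
    proof -
      \<comment> \<open>A vertex sees its whole column, so a column meeting \<open>S\<close> cannot
        meet \<open>U\<close>.\<close>
      have False if c: "c \<in> s j" for c
      proof -
        have "c < k" using c S_sub by (auto simp: s_def)
        then show False
          using disj[of "(c, j - 1)"] c nb[of c j] j by (auto simp: s_def)
      qed
      then show ?thesis by blast
    qed
  qed
  moreover have "card S = (\<Sum>j=1..l. card (s j))"
  proof -
    have "S = (\<Union>j\<in>{1..l}. (\<lambda>c. (c, j - 1)) ` s j)"
    proof (intro set_eqI iffI)
      fix v assume v: "v \<in> S"
      then show "v \<in> (\<Union>j\<in>{1..l}. (\<lambda>c. (c, j - 1)) ` s j)"
        using S_sub by (cases v) (force simp: s_def intro!: bexI[of _ "Suc (snd v)"])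
    qed (auto simp: s_def)
    also have "card \<dots> = (\<Sum>j=1..l. card ((\<lambda>c. (c, j - 1)) ` s j))"
    proof (rule card_UN_disjoint)
      have "finite (s j)" for j
        by (rule finite_subset[of _ "{..<k}"]) (use S_sub in \<open>auto simp: s_def\<close>)
      then show "\<forall>j\<in>{1..l}. finite ((\<lambda>c. (c, j - 1)) ` s j)" by simp
    qed (auto simp: s_def)
    also have "\<dots> = (\<Sum>j=1..l. card (s j))"
      by (intro sum.cong refl card_image) (auto simp: inj_on_def)
    finally show ?thesis .
  qed
  ultimately show ?thesis by simp
qed

section \<open>Lower bound by an explicit fort\<close>

lemma failed_card_attained:
  assumes k: "k \<ge> 2" and l: "l \<ge> 1"
  shows "\<exists>S. failed_power_dominating (complete_graph k \<box> path_graph l) S \<and>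
    card S = (k - 2) * ((l - 1) div 2)"
proof -
  let ?G = "complete_graph k \<box> path_graph l"
  define S where "S = {2..<k} \<times> (\<lambda>i. 2 * i + 1) ` {..<(l - 1) div 2}"
  \<comment> \<open>Including the last column makes every column outside \<open>J\<close> odd and
    interior, with both neighbouring columns in \<open>J\<close>.\<close>
  define J where "J = {j. j < l \<and> (even j \<or> Suc j = l)}"
  define U :: "(nat \<times> nat) set" where "U = {0, 1} \<times> J"
  have fin: "finite (verts ?G)" by (simp add: verts_complete_path)
  have S_sub: "S \<subseteq> verts ?G" by (auto simp: S_def verts_complete_path)
  have disj: "closed_nbhd ?G v \<inter> U = {}" if "v \<in> S" for v
  proof -
    from that obtain c i where v: "v = (c, 2 * i + 1)" "2 \<le> c" "c < k" "i < (l - 1) div 2"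
      by (auto simp: S_def)
    \<comment> \<open>So the columns of \<open>S\<close> stop before the last one and avoid
      \<open>J\<close>.\<close>
    have "2 * i + 2 < l" using v(4) by simp
    then show ?thesis
      using v by (auto simp: closed_nbhd_complete_path U_def J_def)
  qed
  have "closed_nbhd ?G v \<inter> U \<noteq> {x}" if v: "v \<in> verts ?G - U" for v x
  proof -
    obtain c j where cj: "v = (c, j)" "c < k" "j < l"
      using v by (auto simp: verts_complete_path)
    show ?thesis
    proof (cases "j \<in> J")
      case True
      then have "{(0, j), (1, j)} \<subseteq> closed_nbhd ?G v \<inter> U"
        using cj k by (auto simp: closed_nbhd_complete_path U_def)
      then show ?thesis by (rule not_singleton_if_pair_subset) simp
    next
      case False
      then have j: "odd j" "Suc j < l" using cj by (auto simp: J_def)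
      then obtain i where i: "j = Suc i" by (cases j) auto
      show ?thesis
      proof (cases "c < 2")
        case True
        then have "{(c, i), (c, Suc j)} \<subseteq> closed_nbhd ?G v \<inter> U"
          using cj j i by (auto simp: closed_nbhd_complete_path U_def J_def)
        then show ?thesis by (rule not_singleton_if_pair_subset) (simp add: i)
      next
        case c: False
        then have "closed_nbhd ?G v \<inter> U = {}"
          using cj False by (auto simp: closed_nbhd_complete_path U_def)
        then show ?thesis by simp
      qed
    qed
  qed
  moreover have "U \<subseteq> verts ?G" using k by (auto simp: U_def J_def verts_complete_path)
  moreover have "(0, 0) \<in> U" using l by (simp add: U_def J_def)
  ultimately have "fort ?G U" unfolding fort_def by blast
  then have "failed_power_dominating ?G S"
    using failed_power_dominating_iff_fort[OF fin] S_sub disj by blast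
  moreover have "card S = (k - 2) * ((l - 1) div 2)"
    by (simp add: S_def card_cartesian_product card_image inj_on_def)
  ultimately show ?thesis by blast
qed

theorem theorem8:
  fixes k l :: nat
  assumes "k \<ge> 3" and "l \<ge> 3"
  shows "failed_power_domination_number (complete_graph k \<box> path_graph l)
           = (k - 2) * ((l - 1) div 2)"
  unfolding failed_power_domination_number_def
proof (rule Max_eqI)
  show "finite {card S | S. failed_power_dominating (complete_graph k \<box> path_graph l) S}"
    by (rule failed_cards_finite_nonempty(1))
      (use assms in \<open>auto simp: verts_complete_path lessThan_empty_iff\<close>)
  show "n \<le> (k - 2) * ((l - 1) div 2)"
    if "n \<in> {card S | S. failed_power_dominating (complete_graph k \<box> path_graph l) S}" for n
    using that failed_card_le[OF assms(1)] by auto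
  show "(k - 2) * ((l - 1) div 2) \<in>
      {card S | S. failed_power_dominating (complete_graph k \<box> path_graph l) S}"
    using failed_card_attained[of k l] assms by force
qed

end
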